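(* Let $B=\begin{pmatrix}5&2\\2&1\end{pmatrix}$, $\phi=(\frac34,\frac14)$ and $\psi=(\frac14,\frac14)$. Let $\phi'=\pm\phi+\eta$ and $\psi'=\pm\psi+\theta$ for some $\eta,\theta\in\mathbf Z^2$ (and any choices of signs), and let $\gamma=px+qy$, with $(p,q)$ a relatively prime pair of integers, be a knot satisfying $$(\phi'-\psi')(B+I)\begin{pmatrix}p\\ q\end{pmatrix}=0.$$ Then both $\rho_{\phi'}$ and $\rho_{\psi'}$ are central when restricted to $\partial(M-N_\gamma)$.
   Context: $M=T\times[0,1]/\big((m(x),1)\sim(x,0)\big)$ is the mapping torus of an orientation preserving homeomorphism $m$ of the torus $T$. With a basis $x,y$ of $\pi_1T=H_1(T;\mathbf Z)=\mathbf Z^2$, the monodromy matrix $B=\begin{pmatrix}a&b\\c&d\end{pmatrix}\in SL_2(\mathbf Z)$ is given by $m_*(x)=ax+cy$, $m_*(y)=bx+dy$, and $$\pi_1M=\langle x,y,\tau\mid[x,y],\ \tau x\tau^{-1}=x^ay^c,\ \tau y\tau^{-1}=x^by^d\rangle.$$ $SU(2)$ is identified with the unit quaternions. For $\phi=(\phi_1,\phi_2)\in\mathbf R^2$ (a row vector), $\rho_\phi$ is given by $\tau\mapsto j$, $x\mapsto e^{2\pi i\phi_1}$, $y\mapsto e^{2\pi i\phi_2}$; it defines a representation $\pi_1M\to SU(2)$ if and only if $\phi(B+I)\in\mathbf Z^2$. For a relatively prime pair $(p,q)$, $N_\gamma$ is a tubular neighbourhood in $M$ of the simple closed curve $\gamma=px+qy$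 on $T=T\times\{0\}$. A representation is central when restricted to $\partial(M-N_\gamma)$ if the image of $\pi_1(\partial(M-N_\gamma))$ lies in the center $\{\pm1\}$ of $SU(2)$. *)

theory Defs
  imports "HOL-Analysis.Analysis" "HOL-Homology.Homology"
begin

section \<open>Fundamental groups\<close>

definition loops_at :: "'a::topological_space set \<Rightarrow> 'a \<Rightarrow> (real \<Rightarrow> 'a) set" where
  "loops_at S b = {l. path l \<and> path_image l \<subseteq> S \<and> pathstart l = b \<and> pathfinish l = b}"

definition path_class :: "'a::topological_space set \<Rightarrow> (real \<Rightarrow> 'a) \<Rightarrow> (real \<Rightarrow> 'a) set" where
  "path_class S l = {l'. homotopic_paths S l l'}"

text \<open>
  On homotopy classes of loops, all members of each of the unions in this section coincide, so
  taking the union is a choice-free way of computing with representatives. The product of two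
  classes traverses the first loop first.
\<close>

definition pi1 :: "'a::topological_space set \<Rightarrow> 'a \<Rightarrow> (real \<Rightarrow> 'a) set monoid" where
  "pi1 S b =
     \<lparr>carrier = path_class S ` loops_at S b,
      mult = (\<lambda>c d. \<Union>k\<in>c. \<Union>l\<in>d. path_class S (k +++ l)),
      one = path_class S (\<lambda>_. b)\<rparr>"

text \<open>The map of classes induced by a continuous map into \<open>S\<close>.\<close>

definition pi1_induced ::
  "'b::topological_space set \<Rightarrow> ('a::topological_space \<Rightarrow> 'b) \<Rightarrow> (real \<Rightarrow> 'a) set \<Rightarrow> (real \<Rightarrow> 'b) set"
  where "pi1_induced S f c = (\<Union>l\<in>c. path_class S (f \<circ> l))"

text \<open>
  For \<open>A \<subseteq> S\<close> and a path \<open>\<sigma>\<close> in \<open>S\<close> ending in \<open>A\<close>, this is the map from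
  \<open>pi1 A (pathfinish \<sigma>)\<close> to \<open>pi1 S (pathstart \<sigma>)\<close> given by inclusion followed by change of base
  point along \<open>\<sigma>\<close>.
\<close>

definition pi1_along ::
  "'a::topological_space set \<Rightarrow> (real \<Rightarrow> 'a) \<Rightarrow> (real \<Rightarrow> 'a) set \<Rightarrow> (real \<Rightarrow> 'a) set"
  where "pi1_along S \<sigma> c = (\<Union>l\<in>c. path_class S (\<sigma> +++ l +++ reversepath \<sigma>))"

definition path_from_to :: "'a::topological_space set \<Rightarrow> 'a \<Rightarrow> 'a \<Rightarrow> (real \<Rightarrow> 'a) \<Rightarrow> bool" where
  "path_from_to S a b \<sigma> \<longleftrightarrow>
     path \<sigma> \<and> path_image \<sigma> \<subseteq> S \<and> pathstart \<sigma> = a \<and> pathfinish \<sigma> = b"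

text \<open>For abelian \<open>pi1 S b\<close> only: \<open>X\<close> and \<open>Y\<close> form a basis over the integers.\<close>

definition pi1_basis ::
  "'a::topological_space set \<Rightarrow> 'a \<Rightarrow> (real \<Rightarrow> 'a) set \<Rightarrow> (real \<Rightarrow> 'a) set \<Rightarrow> bool" where
  "pi1_basis S b X Y \<longleftrightarrow>
     X \<in> carrier (pi1 S b) \<and> Y \<in> carrier (pi1 S b) \<and>
     (\<forall>c\<in>carrier (pi1 S b). \<exists>!k::int \<times> int.
        c = X [^]\<^bsub>pi1 S b\<^esub> fst k \<otimes>\<^bsub>pi1 S b\<^esub> Y [^]\<^bsub>pi1 S b\<^esub> snd k)"

section \<open>The torus and its mapping tori\<close>

definition torus :: "(complex \<times> complex) set" where
  "torus = sphere 0 1 \<times> sphere 0 1"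

text \<open>A homeomorphism of the torus preserves orientation iff it fixes the fundamental class,
  i.e.\ iff it acts as the identity on the infinite cyclic second homology group.\<close>

definition orientation_preserving_homeo :: "(complex \<times> complex \<Rightarrow> complex \<times> complex) \<Rightarrow> bool" where
  "orientation_preserving_homeo m \<longleftrightarrow>
     homeomorphic_map (top_of_set torus) (top_of_set torus) m \<and>
     (\<forall>c\<in>carrier (homology_group 2 (top_of_set torus)).
        hom_induced 2 (top_of_set torus) {} (top_of_set torus) {} m c = c)"

text \<open>
  \<open>M\<close>, with projection \<open>Q\<close>, is the quotient of \<open>torus \<times> [0,1]\<close> by the equivalence relation
  generated by \<open>(m z, 1) \<sim> (z, 0)\<close>. Since no type can depend on \<open>m\<close>, the quotient is given
  up to homeomorphism as a subspace \<open>M\<close> of an arbitrary ambient space. Mapping tori are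
  Hausdorff, so it is no restriction to take a Hausdorff ambient space.
\<close>

definition is_mapping_torus ::
  "(complex \<times> complex \<Rightarrow> complex \<times> complex) \<Rightarrow> 'a::t2_space set \<Rightarrow>
   ((complex \<times> complex) \<times> real \<Rightarrow> 'a) \<Rightarrow> bool" where
  "is_mapping_torus m M Q \<longleftrightarrow>
     quotient_map (top_of_set (torus \<times> {0..1})) (top_of_set M) Q \<and>
     (\<forall>u\<in>torus \<times> {0..1}. \<forall>v\<in>torus \<times> {0..1}.
        Q u = Q v \<longleftrightarrow>
          u = v \<or>
          u = (m (fst v), 1) \<and> snd v = 0 \<or>
          v = (m (fst u), 1) \<and> snd u = 0)"

text \<open>
  \<open>m\<^sub>*(x) = a x + c y\<close> and \<open>m\<^sub>*(y) = b x + d y\<close> in the (abelian) fundamental group of the torus,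
  where \<open>a b\<close> and \<open>c d\<close> are the rows of \<open>B\<close>. As \<open>m\<close> need not fix the base point, classes at
  \<open>m t\<close> are moved to \<open>t\<close>; which path is used is immaterial.
\<close>

definition is_monodromy_matrix ::
  "(complex \<times> complex \<Rightarrow> complex \<times> complex) \<Rightarrow> complex \<times> complex \<Rightarrow>
   (real \<Rightarrow> complex \<times> complex) set \<Rightarrow> (real \<Rightarrow> complex \<times> complex) set \<Rightarrow> int^2^2 \<Rightarrow> bool" where
  "is_monodromy_matrix m t X Y B \<longleftrightarrow>
     (\<forall>\<beta>. path_from_to torus t (m t) \<beta> \<longrightarrow>
        pi1_along torus \<beta> (pi1_induced torus m X) =
          X [^]\<^bsub>pi1 torus t\<^esub> (B $ 1 $ 1) \<otimes>\<^bsub>pi1 torus t\<^esub> Y [^]\<^bsub>pi1 torus t\<^esub> (B $ 2 $ 1) \<and>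
        pi1_along torus \<beta> (pi1_induced torus m Y) =
          X [^]\<^bsub>pi1 torus t\<^esub> (B $ 1 $ 2) \<otimes>\<^bsub>pi1 torus t\<^esub> Y [^]\<^bsub>pi1 torus t\<^esub> (B $ 2 $ 2))"

definition fibre_incl :: "((complex \<times> complex) \<times> real \<Rightarrow> 'a) \<Rightarrow> complex \<times> complex \<Rightarrow> 'a" where
  "fibre_incl Q z = Q (z, 0)"

text \<open>
  The stable letter: run up the interval over \<open>t\<close>, arriving at \<open>(t, 1) \<sim> (m\<^sup>-\<^sup>1 t, 0)\<close>, then return to
  \<open>(t, 0)\<close> inside the fibre along \<open>\<delta>\<close>. Sliding a loop of the fibre around this loop gives
  \<open>\<tau> z \<tau>\<^sup>-\<^sup>1 = m\<^sub>*(z)\<close> in the fundamental group of the mapping torus.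
\<close>

definition stable_letter ::
  "'a::t2_space set \<Rightarrow> ((complex \<times> complex) \<times> real \<Rightarrow> 'a) \<Rightarrow> complex \<times> complex \<Rightarrow>
   (real \<Rightarrow> complex \<times> complex) \<Rightarrow> (real \<Rightarrow> 'a) set" where
  "stable_letter M Q t \<delta> = path_class M ((\<lambda>s. Q (t, s)) +++ (fibre_incl Q \<circ> \<delta>))"

section \<open>Curves and tubular neighbourhoods\<close>

text \<open>A simple closed curve \<open>g\<close> on the torus representing \<open>p x + q y\<close>; it need not pass
  through the base point \<open>t\<close>.\<close>

definition is_torus_curve ::
  "complex \<times> complex \<Rightarrow> (real \<Rightarrow> complex \<times> complex) set \<Rightarrow> (real \<Rightarrow> complex \<times> complex) set \<Rightarrow>
   int \<Rightarrow> int \<Rightarrow> (real \<Rightarrow> complex \<times> complex) \<Rightarrow> bool" where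
  "is_torus_curve t X Y p q g \<longleftrightarrow>
     simple_path g \<and> path_image g \<subseteq> torus \<and> pathfinish g = pathstart g \<and>
     (\<forall>\<sigma>. path_from_to torus t (pathstart g) \<sigma> \<longrightarrow>
        pi1_along torus \<sigma> (path_class torus g) =
          X [^]\<^bsub>pi1 torus t\<^esub> p \<otimes>\<^bsub>pi1 torus t\<^esub> Y [^]\<^bsub>pi1 torus t\<^esub> q)"

text \<open>
  \<open>N\<close> is an open tubular neighbourhood of the closed curve \<open>K\<close>: the unit disc bundle in an open
  embedding \<open>e\<close> of the (trivial, as \<open>M\<close> is orientable) normal bundle \<open>S\<^sup>1 \<times> \<real>\<^sup>2\<close> carrying the
  zero section onto \<open>K\<close>.
\<close>

definition is_tubular_nbhd :: "'a::t2_space set \<Rightarrow> 'a set \<Rightarrow> 'a set \<Rightarrow> bool" where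
  "is_tubular_nbhd M K N \<longleftrightarrow>
     (\<exists>e :: complex \<times> complex \<Rightarrow> 'a.
        embedding_map (top_of_set (sphere 0 1 \<times> UNIV)) (top_of_set M) e \<and>
        openin (top_of_set M) (e ` (sphere 0 1 \<times> UNIV)) \<and>
        e ` (sphere 0 1 \<times> {0}) = K \<and>
        e ` (sphere 0 1 \<times> ball 0 1) = N)"

text \<open>Because \<open>N\<close> extends to a larger bundle, \<open>M - N\<close> is a manifold with boundary, and its
  boundary is its topological frontier in \<open>M\<close>.\<close>

definition exterior_boundary :: "'a::t2_space set \<Rightarrow> 'a set \<Rightarrow> 'a set" where
  "exterior_boundary M N = top_of_set M frontier_of (M - N)"

section \<open>Representations in SU(2)\<close>

definition SU2 :: "(complex^2^2) monoid" where
  "SU2 = \<lparr>carrier = {A. A ** transpose (map_matrix cnj A) = mat 1 \<and> det A = 1},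
          mult = (**), one = mat 1\<rparr>"

text \<open>The matrix of the quaternion \<open>z + w j\<close>, for complex \<open>z\<close> and \<open>w\<close> (note \<open>j z = cnj z j\<close>).\<close>

definition quat :: "complex \<Rightarrow> complex \<Rightarrow> complex^2^2" where
  "quat z w = vector [vector [z, w], vector [- cnj w, cnj z]]"

lemma mat2_eq_iff:
  "A = C \<longleftrightarrow> A $ 1 $ 1 = C $ 1 $ 1 \<and> A $ 1 $ 2 = C $ 1 $ 2 \<and> A $ 2 $ 1 = C $ 2 $ 1 \<and> A $ 2 $ 2 = C $ 2 $ 2"
  for A C :: "'a^2^2"
  by (simp add: vec_eq_iff forall_2)

lemma mat2_mult: "(A ** C) $ i $ j = A $ i $ 1 * C $ 1 $ j + A $ i $ 2 * C $ 2 $ j"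
  for A C :: "'a::semiring_1^2^2"
  by (simp add: matrix_matrix_mult_def sum_2)

lemma quat_nth [simp]:
  "quat z w $ 1 $ 1 = z" "quat z w $ 1 $ 2 = w" "quat z w $ 2 $ 1 = - cnj w" "quat z w $ 2 $ 2 = cnj z"
  by (simp_all add: quat_def)

lemma i_j_in_SU2: "quat \<i> 0 \<in> carrier SU2" "quat 0 1 \<in> carrier SU2"
  by (simp_all add: SU2_def det_2 mat2_eq_iff mat2_mult transpose_def mat_def)

lemma center_SU2:
  "{A \<in> carrier SU2. \<forall>C\<in>carrier SU2. A \<otimes>\<^bsub>SU2\<^esub> C = C \<otimes>\<^bsub>SU2\<^esub> A} = {mat 1, - mat 1}"
proof (intro equalityI subsetI)
  fix A assume "A \<in> {A \<in> carrier SU2. \<forall>C\<in>carrier SU2. A \<otimes>\<^bsub>SU2\<^esub> C = C \<otimes>\<^bsub>SU2\<^esub> A}"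
  then have A: "A \<in> carrier SU2" and comm: "\<And>C. C \<in> carrier SU2 \<Longrightarrow> A ** C = C ** A"
    by (simp_all add: SU2_def)
  have off: "A $ 1 $ 2 = 0" "A $ 2 $ 1 = 0"
    using comm[OF i_j_in_SU2(1)] by (simp_all add: mat2_eq_iff mat2_mult complex_eq_iff)
  have diag: "A $ 1 $ 1 = A $ 2 $ 2"
    using arg_cong[OF comm[OF i_j_in_SU2(2)], of "\<lambda>C. C $ 1 $ 2"] by (simp add: mat2_mult)
  have "A $ 2 $ 2 * A $ 2 $ 2 = 1"
    using A off diag by (simp add: SU2_def det_2)
  then have "A $ 2 $ 2 = 1 \<or> A $ 2 $ 2 = -1"
    by (simp add: square_eq_1_iff)
  then show "A \<in> {mat 1, - mat 1}"
    using off diag by (auto simp: mat2_eq_iff mat_def)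
next
  fix A :: "complex^2^2" assume "A \<in> {mat 1, - mat 1}"
  then consider "A = mat 1" | "A = - mat 1" by blast
  then show "A \<in> {A \<in> carrier SU2. \<forall>C\<in>carrier SU2. A \<otimes>\<^bsub>SU2\<^esub> C = C \<otimes>\<^bsub>SU2\<^esub> A}"
    by cases (simp_all add: SU2_def det_2 mat2_eq_iff mat2_mult transpose_def mat_def)
qed

text \<open>
  \<open>\<rho>\<close> is the representation of \<open>G\<close> that is given on the generators by \<open>\<tau> \<mapsto> j\<close>,
  \<open>x \<mapsto> exp (2 \<pi> i \<phi>\<^sub>1)\<close>, \<open>y \<mapsto> exp (2 \<pi> i \<phi>\<^sub>2)\<close>.
\<close>

definition is_rho ::
  "'g monoid \<Rightarrow> 'g \<Rightarrow> 'g \<Rightarrow> 'g \<Rightarrow> real^2 \<Rightarrow> ('g \<Rightarrow> complex^2^2) \<Rightarrow> bool" where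
  "is_rho G x y \<tau> \<phi> \<rho> \<longleftrightarrow>
     \<rho> \<in> hom G SU2 \<and>
     \<rho> \<tau> = quat 0 1 \<and>
     \<rho> x = quat (exp (2 * pi * \<i> * complex_of_real (\<phi> $ 1))) 0 \<and>
     \<rho> y = quat (exp (2 * pi * \<i> * complex_of_real (\<phi> $ 2))) 0"

text \<open>
  The restriction of a representation of \<open>pi1 M b\<close> to a subspace \<open>A\<close> depends, up to
  conjugation, on a path from \<open>b\<close> to \<open>A\<close>; centrality is required for all of them.
\<close>

definition central_on ::
  "'a::topological_space set \<Rightarrow> 'a \<Rightarrow> 'a set \<Rightarrow> ((real \<Rightarrow> 'a) set \<Rightarrow> complex^2^2) \<Rightarrow> bool" where
  "central_on M b A \<rho> \<longleftrightarrow>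
     (\<forall>c\<in>A. \<forall>\<sigma>. path_from_to M b c \<sigma> \<longrightarrow>
        \<rho> ` pi1_along M \<sigma> ` carrier (pi1 A c) \<subseteq> {mat 1, - mat 1})"

end

theory Submission
  imports Defs
begin

text \<open>
  The knot \<open>\<gamma>\<close> is the core of its tubular neighbourhood, so every loop in the boundary of the knot
  exterior can be pushed through the neighbourhood onto \<open>\<gamma>\<close>, and is then freely homotopic in \<open>M\<close> to a
  power of \<open>\<gamma>\<close>; the meridian, in particular, dies. A representation of the fundamental group of \<open>M\<close>
  that sends \<open>\<gamma>\<close> to \<open>1\<close> or \<open>-1\<close> is therefore central on the boundary: free homotopy changes its values
  by conjugation only, and conjugation does not move central elements.

  It remains to see that \<open>\<gamma> = p x + q y\<close> goes to \<open>1\<close> or \<open>-1\<close>. Its image is \<open>exp (2 \<pi> i (p \<phi>\<^sub>1 + q \<phi>\<^sub>2))\<close>,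
  with \<open>\<phi>'\<close> or \<open>\<psi>'\<close> for \<open>\<phi>\<close>, so the phase must be a multiple of \<open>1 / 2\<close>. The row vector
  \<open>(\<phi>' - \<psi>') (B + I)\<close> has two odd entries, so the orthogonality condition makes \<open>p + q\<close> even, which is
  exactly what the phases \<open>(3 p + q) / 4\<close> and \<open>(p + q) / 4\<close>, up to sign and integers, need.

  The topological half is \<open>central_on_exterior_boundary\<close>, which rests on
  \<open>exterior_boundary_loop_retracts_to_core\<close> (pushing to the core),
  \<open>simple_closed_curve_periodic_parametrization\<close> (loops in a simple closed curve are powers of it) and
  \<open>hom_central_value_free_homotopy\<close>. The arithmetical half is \<open>phase_of_orthogonal_class\<close>.
\<close>

section \<open>The fundamental group\<close>

lemma loops_at_iff_path_from_to: "l \<in> loops_at S b \<longleftrightarrow> path_from_to S b b l"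
  by (auto simp: loops_at_def path_from_to_def)

lemma path_from_to_join:
  "path_from_to S a b p \<Longrightarrow> path_from_to S b c q \<Longrightarrow> path_from_to S a c (p +++ q)"
  by (auto simp: path_from_to_def subset_path_image_join)

lemma path_from_to_reverse: "path_from_to S a b p \<Longrightarrow> path_from_to S b a (reversepath p)"
  by (auto simp: path_from_to_def)

lemma path_from_to_const: "a \<in> S \<Longrightarrow> path_from_to S a a (\<lambda>_. a)"
  by (auto simp: path_from_to_def path_image_def pathstart_def pathfinish_def path_def)

lemma path_from_to_image:
  assumes "path_from_to S a b p" "continuous_on S f" "f \<in> S \<rightarrow> T"
  shows "path_from_to T (f a) (f b) (f \<circ> p)"
  using assms path_continuous_image[of p f] continuous_on_subset[of S f]
  by (auto simp: path_from_to_def pathstart_compose pathfinish_compose path_image_compose)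

lemma homotopic_paths_from_to_refl: "path_from_to S a b p \<Longrightarrow> homotopic_paths S p p"
  by (simp add: path_from_to_def)

lemma homotopic_paths_from_to:
  "homotopic_paths S p q \<Longrightarrow> path_from_to S a b p \<Longrightarrow> path_from_to S a b q"
  using homotopic_paths_imp_path homotopic_paths_imp_pathfinish homotopic_paths_imp_pathstart
    homotopic_paths_imp_subset
  unfolding path_from_to_def by metis

lemma homotopic_paths_join_from_to:
  assumes "path_from_to S a b p" "path_from_to S b c q"
    and "homotopic_paths S p p'" "homotopic_paths S q q'"
  shows "homotopic_paths S (p +++ q) (p' +++ q')"
  using assms by (intro homotopic_paths_join) (auto simp: path_from_to_def)

lemma homotopic_paths_assoc_from_to:
  assumes "path_from_to S a b p" "path_from_to S b c q" "path_from_to S c d r"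
  shows "homotopic_paths S ((p +++ q) +++ r) (p +++ (q +++ r))"
  using assms by (intro homotopic_paths_sym[OF homotopic_paths_assoc]) (auto simp: path_from_to_def)

lemma convex_homotopic_paths:
  fixes S :: "'a::real_normed_vector set"
  assumes "convex S" "path_from_to S a b p" "path_from_to S a b q"
  shows "homotopic_paths S p q"
  using convex_imp_simply_connected[OF assms(1)] assms(2,3)
  unfolding simply_connected_eq_homotopic_paths path_from_to_def by metis

text \<open>
  Any two reparametrizations of a path with the same ends are homotopic, because the interval that
  parametrizes it is convex. The unit and inverse laws below are instances. In a general topological
  space this replaces arguments with straight lines in the target.
\<close>

lemma homotopic_paths_reparametrize_along:
  fixes u v :: "real \<Rightarrow> real"
  assumes p: "path_from_to S a b p" and u: "path_from_to {0..1} x y u" and v: "path_from_to {0..1} x y v"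
  shows "homotopic_paths S (p \<circ> u) (p \<circ> v)"
proof (rule homotopic_paths_continuous_image)
  show "homotopic_paths {0..1} u v"
    by (rule convex_homotopic_paths[OF _ u v]) simp
  show "continuous_on {0..1} p" "p \<in> {0..1} \<rightarrow> S"
    using p by (auto simp: path_from_to_def path_def path_image_def)
qed

lemma path_from_to_unit_interval: "path_from_to {0..1} 0 1 (id :: real \<Rightarrow> real)"
  by (simp add: path_from_to_def path_def path_image_def pathstart_def pathfinish_def)

lemma homotopic_paths_const_join:
  assumes "path_from_to S a b p"
  shows "homotopic_paths S ((\<lambda>_. a) +++ p) p"
proof -
  have "p 0 = a"
    using assms by (simp add: path_from_to_def pathstart_def)
  then have "(\<lambda>_. a) +++ p = p \<circ> ((\<lambda>_. 0) +++ id)"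
    by (simp add: joinpaths_def fun_eq_iff)
  then show ?thesis
    using homotopic_paths_reparametrize_along[OF assms path_from_to_join[OF
        path_from_to_const path_from_to_unit_interval] path_from_to_unit_interval]
    by simp
qed

lemma homotopic_paths_reverse_join:
  assumes "path_from_to S a b p"
  shows "homotopic_paths S (reversepath p +++ p) (\<lambda>_. b)"
proof -
  have end_p: "p 1 = b"
    using assms by (simp add: path_from_to_def pathfinish_def)
  have "reversepath p +++ p = p \<circ> (reversepath id +++ id)"
    by (simp add: joinpaths_def reversepath_def fun_eq_iff)
  then show ?thesis
    using homotopic_paths_reparametrize_along[OF assms path_from_to_join[OF
        path_from_to_reverse[OF path_from_to_unit_interval] path_from_to_unit_interval]
        path_from_to_const]
    by (simp add: end_p)
qed

lemma path_class_eqI: "homotopic_paths S p q \<Longrightarrow> path_class S p = path_class S q"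
  unfolding path_class_def by (blast intro: homotopic_paths_trans homotopic_paths_sym)

text \<open>
  A union over the representatives of a class collapses to the value at any one of them as soon as
  the operation respects homotopy. The products, induced maps and changes of base point are all
  defined by such unions, so this lemma reduces each of them to a computation with one loop.
\<close>

lemma Union_path_class:
  assumes "path_from_to A a b l"
    and "\<And>l'. homotopic_paths A l l' \<Longrightarrow> homotopic_paths S (F l) (F l')"
  shows "(\<Union>l'\<in>path_class A l. path_class S (F l')) = path_class S (F l)"
proof -
  have "path_class S (F l') = path_class S (F l)" if "l' \<in> path_class A l" for l'
    using that assms(2) path_class_eqI unfolding path_class_def by blast
  moreover have "l \<in> path_class A l"
    using homotopic_paths_from_to_refl[OF assms(1)] by (simp add: path_class_def)
  ultimately show ?thesis by blast
qed

lemma pi1_mult_class: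
  assumes k: "path_from_to S b b k" and l: "path_from_to S b b l"
  shows "path_class S k \<otimes>\<^bsub>pi1 S b\<^esub> path_class S l = path_class S (k +++ l)"
proof -
  have inner: "(\<Union>l'\<in>path_class S l. path_class S (k' +++ l')) = path_class S (k' +++ l)"
    if "homotopic_paths S k k'" for k'
  proof (rule Union_path_class[OF l])
    note k' = homotopic_paths_from_to[OF that k]
    fix l' assume "homotopic_paths S l l'"
    then show "homotopic_paths S (k' +++ l) (k' +++ l')"
      by (rule homotopic_paths_join_from_to[OF k' l homotopic_paths_from_to_refl[OF k']])
  qed
  then have "(\<Union>k'\<in>path_class S k. \<Union>l'\<in>path_class S l. path_class S (k' +++ l')) =
      (\<Union>k'\<in>path_class S k. path_class S (k' +++ l))"
    using inner by (simp add: path_class_def)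
  also have "\<dots> = path_class S (k +++ l)"
    by (rule Union_path_class[OF k]) (rule homotopic_paths_join_from_to[OF k l _
          homotopic_paths_from_to_refl[OF l]])
  finally show ?thesis by (simp add: pi1_def)
qed

lemma pi1_carrier_iff: "c \<in> carrier (pi1 S b) \<longleftrightarrow> (\<exists>l. path_from_to S b b l \<and> c = path_class S l)"
  by (auto simp: pi1_def loops_at_iff_path_from_to)

lemma path_class_in_pi1: "path_from_to S b b l \<Longrightarrow> path_class S l \<in> carrier (pi1 S b)"
  by (auto simp: pi1_carrier_iff)

lemma pi1_induced_class:
  assumes "path_from_to S a b l" "continuous_on S f" "f \<in> S \<rightarrow> T"
  shows "pi1_induced T f (path_class S l) = path_class T (f \<circ> l)"
  unfolding pi1_induced_def
  by (rule Union_path_class[OF assms(1)]) (rule homotopic_paths_continuous_image[OF _ assms(2,3)])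

lemma pi1_along_class:
  assumes \<sigma>: "path_from_to S a c \<sigma>" and l: "path_from_to A c c l" and "A \<subseteq> S"
  shows "pi1_along S \<sigma> (path_class A l) = path_class S (\<sigma> +++ l +++ reversepath \<sigma>)"
  unfolding pi1_along_def
proof (rule Union_path_class[OF l])
  fix l' assume "homotopic_paths A l l'"
  then have ll': "homotopic_paths S l l'"
    using \<open>A \<subseteq> S\<close> homotopic_paths_subset by blast
  have l_S: "path_from_to S c c l"
    using l \<open>A \<subseteq> S\<close> by (auto simp: path_from_to_def)
  note rev = path_from_to_reverse[OF \<sigma>]
  show "homotopic_paths S (\<sigma> +++ l +++ reversepath \<sigma>) (\<sigma> +++ l' +++ reversepath \<sigma>)"
    by (rule homotopic_paths_join_from_to[OF \<sigma> path_from_to_join[OF l_S rev]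
        homotopic_paths_from_to_refl[OF \<sigma>]
        homotopic_paths_join_from_to[OF l_S rev ll' homotopic_paths_from_to_refl[OF rev]]])
qed

lemma group_pi1:
  assumes "b \<in> S"
  shows "group (pi1 S b)"
proof (rule groupI)
  have one: "\<one>\<^bsub>pi1 S b\<^esub> = path_class S (\<lambda>_. b)"
    by (simp add: pi1_def)
  show "\<one>\<^bsub>pi1 S b\<^esub> \<in> carrier (pi1 S b)"
    using path_class_in_pi1[OF path_from_to_const[OF assms]] one by simp
  fix x assume "x \<in> carrier (pi1 S b)"
  then obtain k where k: "path_from_to S b b k" "x = path_class S k"
    by (auto simp: pi1_carrier_iff)
  have "homotopic_paths S ((\<lambda>_. b) +++ k) k"
    by (rule homotopic_paths_const_join[OF k(1)])
  then show "\<one>\<^bsub>pi1 S b\<^esub> \<otimes>\<^bsub>pi1 S b\<^esub> x = x"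
    using k one pi1_mult_class[OF path_from_to_const[OF assms] k(1)] path_class_eqI by simp
  have "homotopic_paths S (reversepath k +++ k) (\<lambda>_. b)"
    by (rule homotopic_paths_reverse_join[OF k(1)])
  then have "path_class S (reversepath k) \<otimes>\<^bsub>pi1 S b\<^esub> x = \<one>\<^bsub>pi1 S b\<^esub>"
    using k one pi1_mult_class[OF path_from_to_reverse[OF k(1)] k(1)] path_class_eqI by simp
  then show "\<exists>y\<in>carrier (pi1 S b). y \<otimes>\<^bsub>pi1 S b\<^esub> x = \<one>\<^bsub>pi1 S b\<^esub>"
    using path_class_in_pi1[OF path_from_to_reverse[OF k(1)]] by blast
  fix y assume "y \<in> carrier (pi1 S b)"
  then obtain l where l: "path_from_to S b b l" "y = path_class S l"
    by (auto simp: pi1_carrier_iff)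
  note kl = path_from_to_join[OF k(1) l(1)]
  show "x \<otimes>\<^bsub>pi1 S b\<^esub> y \<in> carrier (pi1 S b)"
    using path_class_in_pi1[OF kl] pi1_mult_class[OF k(1) l(1)] k l by simp
  fix z assume "z \<in> carrier (pi1 S b)"
  then obtain m where m: "path_from_to S b b m" "z = path_class S m"
    by (auto simp: pi1_carrier_iff)
  show "(x \<otimes>\<^bsub>pi1 S b\<^esub> y) \<otimes>\<^bsub>pi1 S b\<^esub> z = x \<otimes>\<^bsub>pi1 S b\<^esub> (y \<otimes>\<^bsub>pi1 S b\<^esub> z)"
    using k l m pi1_mult_class[OF k(1) l(1)] pi1_mult_class[OF l(1) m(1)]
      pi1_mult_class[OF kl m(1)] pi1_mult_class[OF k(1) path_from_to_join[OF l(1) m(1)]]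
      path_class_eqI[OF homotopic_paths_assoc_from_to[OF k(1) l(1) m(1)]]
    by simp
qed

lemma pi1_induced_hom:
  assumes "continuous_on S f" "f \<in> S \<rightarrow> T"
  shows "pi1_induced T f \<in> hom (pi1 S b) (pi1 T (f b))"
proof (rule homI)
  fix x assume "x \<in> carrier (pi1 S b)"
  then obtain k where k: "path_from_to S b b k" "x = path_class S k"
    by (auto simp: pi1_carrier_iff)
  note fk = path_from_to_image[OF k(1) assms]
  show "pi1_induced T f x \<in> carrier (pi1 T (f b))"
    using path_class_in_pi1[OF fk] pi1_induced_class[OF k(1) assms] k by simp
  fix y assume "y \<in> carrier (pi1 S b)"
  then obtain l where l: "path_from_to S b b l" "y = path_class S l"
    by (auto simp: pi1_carrier_iff)
  show "pi1_induced T f (x \<otimes>\<^bsub>pi1 S b\<^esub> y) = pi1_induced T f x \<otimes>\<^bsub>pi1 T (f b)\<^esub> pi1_induced T f y"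
    using k l pi1_mult_class[OF k(1) l(1)] pi1_induced_class[OF k(1) assms]
      pi1_induced_class[OF l(1) assms] pi1_induced_class[OF path_from_to_join[OF k(1) l(1)] assms]
      pi1_mult_class[OF fk path_from_to_image[OF l(1) assms]]
    by (simp add: path_compose_join)
qed

section \<open>Change of base point and free homotopy\<close>

text \<open>
  The return path \<open>q\<close> after \<open>l\<close> and the outgoing path \<open>q\<close> before \<open>m\<close> cancel. With three possibly
  different connecting paths \<open>p\<close>, \<open>q\<close>, \<open>r\<close>, this one computation serves both for the additivity of
  the powers of a loop and for comparing loops that are joined to the base point differently.
\<close>

lemma homotopic_paths_cancel_middle:
  assumes p: "path_from_to S a b p" and l: "path_from_to S b c l" and q: "path_from_to S d c q"
    and m: "path_from_to S c e m" and r: "path_from_to S e f r"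
  shows "homotopic_paths S ((p +++ l +++ reversepath q) +++ (q +++ m +++ r)) (p +++ (l +++ m) +++ r)"
proof -
  note q' = path_from_to_reverse[OF q]
  note mr = path_from_to_join[OF m r]
  note qmr = path_from_to_join[OF q mr]
  note lq' = path_from_to_join[OF l q']
  have "homotopic_paths S (reversepath q +++ q) (\<lambda>_. c)"
    by (rule homotopic_paths_reverse_join[OF q])
  then have "homotopic_paths S ((reversepath q +++ q) +++ m +++ r) ((\<lambda>_. c) +++ m +++ r)"
    by (intro homotopic_paths_join_from_to[OF path_from_to_join[OF q' q] mr]
        homotopic_paths_from_to_refl[OF mr])
  moreover have "homotopic_paths S ((\<lambda>_. c) +++ m +++ r) (m +++ r)"
    by (rule homotopic_paths_const_join[OF mr])
  ultimately have 1: "homotopic_paths S (reversepath q +++ q +++ m +++ r) (m +++ r)"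
    using homotopic_paths_assoc_from_to[OF q' q mr] homotopic_paths_sym homotopic_paths_trans
    by metis
  have "homotopic_paths S ((l +++ reversepath q) +++ q +++ m +++ r)
      (l +++ reversepath q +++ q +++ m +++ r)"
    by (rule homotopic_paths_assoc_from_to[OF l q' qmr])
  also have "homotopic_paths S \<dots> (l +++ m +++ r)"
    by (rule homotopic_paths_join_from_to[OF l path_from_to_join[OF q' qmr]
          homotopic_paths_from_to_refl[OF l] 1])
  also have "homotopic_paths S \<dots> ((l +++ m) +++ r)"
    by (rule homotopic_paths_sym[OF homotopic_paths_assoc_from_to[OF l m r]])
  finally have 2: "homotopic_paths S ((l +++ reversepath q) +++ q +++ m +++ r) ((l +++ m) +++ r)" .
  have "homotopic_paths S ((p +++ l +++ reversepath q) +++ q +++ m +++ r)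
      (p +++ (l +++ reversepath q) +++ q +++ m +++ r)"
    by (rule homotopic_paths_assoc_from_to[OF p lq' qmr])
  also have "homotopic_paths S \<dots> (p +++ (l +++ m) +++ r)"
    by (rule homotopic_paths_join_from_to[OF p path_from_to_join[OF lq' qmr]
          homotopic_paths_from_to_refl[OF p] 2])
  finally show ?thesis .
qed

lemma path_from_to_conjugate:
  assumes "path_from_to S a c p" "path_from_to S c d l" "path_from_to S b d q"
  shows "path_from_to S a b (p +++ l +++ reversepath q)"
  by (intro path_from_to_join[OF assms(1)] path_from_to_join[OF assms(2)]
      path_from_to_reverse assms)

lemma pi1_mult_conjugate:
  assumes \<sigma>: "path_from_to S b c \<sigma>" and l: "path_from_to S c d l" and \<tau>: "path_from_to S b d \<tau>"
    and m: "path_from_to S d e m" and \<upsilon>: "path_from_to S b e \<upsilon>"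
  shows "path_class S (\<sigma> +++ l +++ reversepath \<tau>) \<otimes>\<^bsub>pi1 S b\<^esub>
      path_class S (\<tau> +++ m +++ reversepath \<upsilon>) = path_class S (\<sigma> +++ (l +++ m) +++ reversepath \<upsilon>)"
  using pi1_mult_class[OF path_from_to_conjugate[OF \<sigma> l \<tau>] path_from_to_conjugate[OF \<tau> m \<upsilon>]]
    path_class_eqI[OF homotopic_paths_cancel_middle[OF \<sigma> l \<tau> m path_from_to_reverse[OF \<upsilon>]]]
  by simp

lemma path_class_conjugate_cong:
  assumes "path_from_to S a c p" "path_from_to S c d l" "path_from_to S b d q"
    and "homotopic_paths S l l'"
  shows "path_class S (p +++ l +++ reversepath q) = path_class S (p +++ l' +++ reversepath q)"
proof -
  note rev = path_from_to_reverse[OF assms(3)]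
  show ?thesis
    by (intro path_class_eqI homotopic_paths_join_from_to[OF assms(1)
          path_from_to_join[OF assms(2) rev] homotopic_paths_from_to_refl[OF assms(1)]]
        homotopic_paths_join_from_to[OF assms(2) rev assms(4)]
        homotopic_paths_from_to_refl[OF rev])
qed

text \<open>
  A free homotopy is a map of a square. Let \<open>\<alpha>\<close> be the track of the base point, which runs along
  two opposite sides. In the convex square the two ways around the boundary from one corner to the
  opposite one are homotopic, and their images are \<open>l\<close> followed by \<open>\<alpha>\<close> and \<open>\<alpha>\<close> followed by \<open>l'\<close>.
\<close>

lemma homotopic_loops_track:
  assumes "homotopic_loops S l l'"
  obtains \<alpha> where "path_from_to S (pathstart l) (pathstart l') \<alpha>"
    and "homotopic_paths S (l +++ \<alpha>) (\<alpha> +++ l')"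
proof -
  let ?I = "{0..1::real} \<times> {0..1::real}"
  obtain h where conth: "continuous_on ?I h" and him: "h \<in> ?I \<rightarrow> S"
    and h0: "\<And>x. x \<in> {0..1} \<Longrightarrow> h (0, x) = l x"
    and h1: "\<And>x. x \<in> {0..1} \<Longrightarrow> h (1, x) = l' x"
    and hp: "\<And>u. u \<in> {0..1} \<Longrightarrow> h (u, 1) = h (u, 0)"
    using assms unfolding homotopic_loops by (auto simp: pathstart_def pathfinish_def)
  define side where "side a b = h \<circ> linepath a b" for a b :: "real \<times> real"
  have cvx: "convex ?I"
    by (simp add: convex_Times)
  have line: "path_from_to ?I a b (linepath a b)" if "a \<in> ?I" "b \<in> ?I" for a b
    using that closed_segment_subset[OF _ _ cvx] by (auto simp: path_from_to_def)
  have side: "path_from_to S (h a) (h b) (side a b)" if "a \<in> ?I" "b \<in> ?I" for a b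
    unfolding side_def by (rule path_from_to_image[OF line[OF that] conth him])
  have "homotopic_paths ?I (linepath (0,0) (0,1) +++ linepath (0,1) (1,1))
      (linepath (0,0) (1,0) +++ linepath (1,0) (1,1))"
    by (rule convex_homotopic_paths[OF cvx, of "(0,0)" "(1,1)"])
      (auto intro!: path_from_to_join[OF line line])
  then have square: "homotopic_paths S (side (0,0) (0,1) +++ side (0,1) (1,1))
      (side (0,0) (1,0) +++ side (1,0) (1,1))"
    unfolding side_def path_compose_join[symmetric]
    by (rule homotopic_paths_continuous_image[OF _ conth him])
  have track: "side (0,1) (1,1) x = side (0,0) (1,0) x" if "x \<in> {0..1}" for x
    using hp[OF that] by (simp add: side_def linepath_def)
  have low: "side (0,0) (0,1) x = l x" and high: "side (1,0) (1,1) x = l' x"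
    if "x \<in> {0..1}" for x
    using h0[OF that] h1[OF that] by (simp_all add: side_def linepath_def)
  have corners: "h (0,0) = pathstart l" "h (1,0) = pathstart l'"
    "h (0,1) = pathstart l" "h (1,1) = pathstart l'"
    using h0[of 0] h1[of 0] hp[of 0] hp[of 1] by (simp_all add: pathstart_def)
  have s1: "path_from_to S (pathstart l) (pathstart l) (side (0,0) (0,1))"
    and s2: "path_from_to S (pathstart l) (pathstart l') (side (0,1) (1,1))"
    and s3: "path_from_to S (pathstart l) (pathstart l') (side (0,0) (1,0))"
    and s4: "path_from_to S (pathstart l') (pathstart l') (side (1,0) (1,1))"
    using side[of "(0,0)" "(0,1)"] side[of "(0,1)" "(1,1)"] side[of "(0,0)" "(1,0)"]
      side[of "(1,0)" "(1,1)"] corners by simp_all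
  have eq: "homotopic_paths S f f'" if "path_from_to S a b f" "\<And>x. x \<in> {0..1} \<Longrightarrow> f x = f' x" for f f' a b
    using that by (intro homotopic_paths_eq) (auto simp: path_from_to_def)
  have "homotopic_paths S (side (0,0) (0,1) +++ side (0,1) (1,1)) (l +++ side (0,0) (1,0))"
    by (intro homotopic_paths_join_from_to[OF s1 s2] eq[OF s1] eq[OF s2] low track)
  moreover have "homotopic_paths S (side (0,0) (1,0) +++ side (1,0) (1,1)) (side (0,0) (1,0) +++ l')"
    by (intro homotopic_paths_join_from_to[OF s3 s4] eq[OF s3] eq[OF s4] high refl)
  ultimately have "homotopic_paths S (l +++ side (0,0) (1,0)) (side (0,0) (1,0) +++ l')"
    by (rule homotopic_paths_trans[OF homotopic_paths_sym homotopic_paths_trans[OF square]])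
  with s3 show ?thesis by (rule that)
qed

text \<open>
  Freely homotopic loops give conjugate elements of the fundamental group, whatever paths connect
  them to the base point, and a central element is conjugate to itself only. So it is enough to know
  one value: this is what makes centrality on a subspace independent of base points and paths.
\<close>

lemma hom_central_value_free_homotopy:
  assumes H: "group H" and \<rho>: "\<rho> \<in> hom (pi1 S b) H"
    and ll': "homotopic_loops S l l'"
    and \<sigma>: "path_from_to S b (pathstart l) \<sigma>" and \<sigma>': "path_from_to S b (pathstart l') \<sigma>'"
    and z: "\<rho> (path_class S (\<sigma>' +++ l' +++ reversepath \<sigma>')) = z"
    and central: "\<And>c. c \<in> carrier H \<Longrightarrow> z \<otimes>\<^bsub>H\<^esub> c = c \<otimes>\<^bsub>H\<^esub> z"
  shows "\<rho> (path_class S (\<sigma> +++ l +++ reversepath \<sigma>)) = z"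
proof -
  obtain \<alpha> where \<alpha>: "path_from_to S (pathstart l) (pathstart l') \<alpha>"
    and track: "homotopic_paths S (l +++ \<alpha>) (\<alpha> +++ l')"
    using homotopic_loops_track[OF ll'] .
  have l: "path_from_to S (pathstart l) (pathstart l) l"
    and l': "path_from_to S (pathstart l') (pathstart l') l'"
    using homotopic_loops_imp_loop[OF ll'] homotopic_loops_imp_path[OF ll']
      homotopic_loops_imp_subset[OF ll'] by (auto simp: path_from_to_def)
  define x where "x = path_class S (\<sigma> +++ l +++ reversepath \<sigma>)"
  define x' where "x' = path_class S (\<sigma>' +++ l' +++ reversepath \<sigma>')"
  define y where "y = path_class S (\<sigma> +++ \<alpha> +++ reversepath \<sigma>')"
  have mem: "x \<in> carrier (pi1 S b)" "x' \<in> carrier (pi1 S b)" "y \<in> carrier (pi1 S b)"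
    unfolding x_def x'_def y_def
    by (rule path_class_in_pi1[OF path_from_to_conjugate]; fact)+
  \<comment> \<open>Both products cancel to loops that run along \<open>\<sigma>\<close>, then \<open>l +++ \<alpha>\<close> or \<open>\<alpha> +++ l'\<close>, and back along \<open>\<sigma>'\<close>.\<close>
  have "x \<otimes>\<^bsub>pi1 S b\<^esub> y = y \<otimes>\<^bsub>pi1 S b\<^esub> x'"
    unfolding x_def x'_def y_def pi1_mult_conjugate[OF \<sigma> l \<sigma> \<alpha> \<sigma>'] pi1_mult_conjugate[OF \<sigma> \<alpha> \<sigma>' l' \<sigma>']
    by (rule path_class_conjugate_cong[OF \<sigma> path_from_to_join[OF l \<alpha>] \<sigma>' track])
  then have "\<rho> x \<otimes>\<^bsub>H\<^esub> \<rho> y = \<rho> y \<otimes>\<^bsub>H\<^esub> \<rho> x'"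
    using hom_mult[OF \<rho>] mem by metis
  also have "\<dots> = z \<otimes>\<^bsub>H\<^esub> \<rho> y"
    using central hom_in_carrier[OF \<rho> mem(3)] z by (simp add: x'_def)
  finally show ?thesis
    using group.right_cancel[OF H] hom_in_carrier[OF \<rho>] mem z
    by (metis x_def x'_def)
qed

section \<open>Loops in a simple closed curve\<close>

text \<open>
  The curve itself, and not just its image, is needed as the parameter: the homeomorphism must carry
  the standard loop of the circle to \<open>G\<close>. It exists because a continuous bijection from a compact
  space to a Hausdorff space is a homeomorphism.
\<close>

lemma simple_closed_curve_homeomorphism_circle:
  fixes G :: "real \<Rightarrow> 'a::t2_space"
  assumes G: "simple_path G" and loop: "pathfinish G = pathstart G"
  obtains h k where "homeomorphism (sphere 0 1) (path_image G) h k"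
    and "\<And>s. s \<in> {0..1} \<Longrightarrow> h (exp (\<i> * of_real (2 * pi * s))) = G s"
proof -
  define h where "h = G \<circ> (\<lambda>z. Arg2pi z / (2 * pi))"
  have unit: "Arg2pi z / (2 * pi) \<in> {0..<1}" for z
    using Arg2pi_ge_0[of z] Arg2pi_lt_2pi[of z] by (simp add: field_simps)
  have "homotopic_loops (path_image G) G G"
    by (simp add: homotopic_loops_refl G loop simple_path_imp_path)
  then have "homotopic_with_canon (\<lambda>_. True) (sphere 0 1) (path_image G) h h"
    unfolding h_def by (rule homotopic_loops_imp_homotopic_circlemaps)
  then have cont: "continuous_on (sphere 0 1) h"
    by (simp add: homotopic_with_imp_continuous)
  have h_exp: "h (exp (\<i> * of_real (2 * pi * s))) = G s" if "s \<in> {0..1}" for s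
  proof (cases "s = 1")
    case True
    then have "exp (\<i> * of_real (2 * pi * s)) = 1"
      by (metis cis_conv_exp cis_2pi mult_1_right)
    then show ?thesis
      using Arg2pi_of_real[of 1] loop True by (simp add: h_def pathfinish_def pathstart_def)
  next
    case False
    then have "Arg2pi (exp (\<i> * of_real (2 * pi * s))) = 2 * pi * s"
      using that by (subst Arg2pi_exp) auto
    then show ?thesis by (simp add: h_def)
  qed
  have "\<exists>k. homeomorphism (sphere 0 1) (path_image G) h k"
  proof (rule homeomorphism_compact[OF _ cont])
    show "inj_on h (sphere 0 1)"
    proof
      fix z w :: complex
      assume zw: "z \<in> sphere 0 1" "w \<in> sphere 0 1" and "h z = h w"
      then have "Arg2pi z / (2 * pi) = Arg2pi w / (2 * pi)"
        using G unit[of z] unit[of w] unfolding simple_path_def loop_free_def h_def by fastforce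
      then show "z = w"
        using zw Arg2pi_eq[of z] Arg2pi_eq[of w] by simp
    qed
    show "h ` sphere 0 1 = path_image G"
    proof (intro equalityI subsetI)
      fix y assume "y \<in> h ` sphere 0 1"
      then show "y \<in> path_image G"
        using unit by (fastforce simp: h_def path_image_def)
    next
      fix y assume "y \<in> path_image G"
      then obtain s where s: "s \<in> {0..1}" "y = G s"
        by (auto simp: path_image_def)
      have "exp (\<i> * of_real (2 * pi * s)) \<in> sphere 0 1"
        by simp
      then show "y \<in> h ` sphere 0 1"
        using h_exp[OF s(1)] s(2) by (metis image_eqI)
    qed
  qed auto
  then show ?thesis
    using h_exp that by blast
qed

text \<open>
  \<open>H\<close> is the universal covering of the curve, with \<open>G\<close> as a fundamental period. A loop in the curve
  lifts to a real path \<open>L\<close>, by a continuous logarithm on the unit interval, and \<open>L 1 - L 0\<close> is an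
  integer \<open>n\<close>, the degree. The straight-line homotopy from \<open>L s\<close> to \<open>n * s\<close> keeps this difference
  fixed, so it descends to a free homotopy of loops.
\<close>

lemma simple_closed_curve_periodic_parametrization:
  fixes G :: "real \<Rightarrow> 'a::t2_space"
  assumes G: "simple_path G" and loop: "pathfinish G = pathstart G"
  obtains H :: "real \<Rightarrow> 'a" where "continuous_on UNIV H" "H \<in> UNIV \<rightarrow> path_image G"
    "\<And>x n. H (x + of_int n) = H x" "\<And>s. s \<in> {0..1} \<Longrightarrow> H s = G s"
    "\<And>c l. path_from_to (path_image G) c c l \<Longrightarrow>
       \<exists>n. homotopic_loops (path_image G) l (\<lambda>s. H (of_int n * s))"
proof -
  obtain h k where hk: "homeomorphism (sphere 0 1) (path_image G) h k"
    and h_exp: "\<And>s. s \<in> {0..1} \<Longrightarrow> h (exp (\<i> * of_real (2 * pi * s))) = G s"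
    using simple_closed_curve_homeomorphism_circle[OF assms] by blast
  define circ :: "real \<Rightarrow> complex" where "circ x = exp (\<i> * of_real (2 * pi * x))" for x
  define H where "H = h \<circ> circ"
  have circ_sphere: "circ x \<in> sphere 0 1" for x
    by (simp add: circ_def)
  have circ_eq: "circ x = circ y \<longleftrightarrow> (\<exists>n::int. x = y + of_int n)" for x y
  proof -
    have "(\<i> * of_real (2 * pi * x) = \<i> * of_real (2 * pi * y) + of_real (real_of_int (2 * n) * pi) * \<i>)
        \<longleftrightarrow> x = y + of_int n" for n
    proof -
      have "(\<i> * of_real (2 * pi * x) = \<i> * of_real (2 * pi * y) + of_real (real_of_int (2 * n) * pi) * \<i>)
          \<longleftrightarrow> 2 * pi * x = 2 * pi * (y + of_int n)"
        by (simp add: complex_eq_iff algebra_simps)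
      also have "\<dots> \<longleftrightarrow> x = y + of_int n"
        by simp
      finally show ?thesis .
    qed
    then show ?thesis
      unfolding circ_def exp_eq by metis
  qed
  have H_eq: "H x = H y \<longleftrightarrow> (\<exists>n::int. x = y + of_int n)" for x y
    using circ_eq circ_sphere hk unfolding H_def o_def homeomorphism_def by metis
  have cont_H: "continuous_on UNIV H"
    unfolding H_def
    by (rule continuous_on_compose)
      (auto simp: circ_def intro!: continuous_intros continuous_on_subset[OF homeomorphism_cont1[OF hk]])
  have H_img: "H \<in> UNIV \<rightarrow> path_image G"
    using homeomorphism_image1[OF hk] circ_sphere by (auto simp: H_def)
  have unroll: "\<exists>n. homotopic_loops (path_image G) l (\<lambda>s. H (of_int n * s))"
    if l: "path_from_to (path_image G) c c l" for c l
  proof -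
    have l_img: "l s \<in> path_image G" if "s \<in> {0..1}" for s
      using l that by (auto simp: path_from_to_def path_image_def)
    have cont_kl: "continuous_on {0..1} (k \<circ> l)"
      using path_from_to_image[OF l homeomorphism_cont2[OF hk], of UNIV]
      by (auto simp: path_from_to_def path_def)
    have kl: "k (l s) \<in> sphere 0 1" if "s \<in> {0..1}" for s
      using homeomorphism_image2[OF hk] l_img[OF that] by blast
    have nz: "(k \<circ> l) s \<noteq> 0" if "s \<in> {0..1}" for s
      using kl[OF that] by auto
    have "contractible {0..1::real}"
      by (rule convex_imp_contractible) simp
    from continuous_logarithm_on_contractible[OF cont_kl this nz]
    obtain g where g: "continuous_on {0..1} g" "\<And>s. s \<in> {0..1} \<Longrightarrow> (k \<circ> l) s = exp (g s)"
      by blast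
    define L where "L s = Im (g s) / (2 * pi)" for s
    have L_cont: "continuous_on {0..1} L"
      unfolding L_def by (intro continuous_intros g) simp
    have L: "l s = H (L s)" if "s \<in> {0..1}" for s
    proof -
      \<comment> \<open>A point of the unit circle has purely imaginary logarithms.\<close>
      have "norm (exp (g s)) = 1"
        using g(2)[OF that] kl[OF that] by simp
      then have "g s = \<i> * of_real (2 * pi * L s)"
        by (simp add: L_def complex_eq_iff)
      then have "circ (L s) = k (l s)"
        using g(2)[OF that] by (simp add: circ_def)
      then show ?thesis
        using homeomorphism_apply2[OF hk l_img[OF that]] by (simp add: H_def)
    qed
    have "H (L 1) = H (L 0)"
      using l L[of 0] L[of 1] by (simp add: path_from_to_def pathstart_def pathfinish_def)
    then obtain n :: int where n: "L 1 = L 0 + of_int n"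
      using H_eq by blast
    define F where "F w = (1 - fst w) * L (snd w) + fst w * (of_int n * snd w)" for w
    have "homotopic_loops (path_image G) l (\<lambda>s. H (of_int n * s))"
      unfolding homotopic_loops
    proof (intro exI conjI ballI)
      have "continuous_on ({0..1} \<times> {0..1}) (\<lambda>w. L (snd w))"
        by (rule continuous_on_compose2[OF L_cont]) (auto intro!: continuous_intros)
      then have "continuous_on ({0..1} \<times> {0..1}) F"
        unfolding F_def by (intro continuous_intros)
      then show "continuous_on ({0..1} \<times> {0..1}) (H \<circ> F)"
        by (rule continuous_on_compose) (rule continuous_on_subset[OF cont_H subset_UNIV])
      show "H \<circ> F \<in> {0..1} \<times> {0..1} \<rightarrow> path_image G"
        using H_img by auto
    next
      fix s :: real assume "s \<in> {0..1}"
      then show "(H \<circ> F) (0, s) = l s" "(H \<circ> F) (1, s) = H (of_int n * s)"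
        by (simp_all add: F_def L)
    next
      fix u :: real
      have "F (u, 1) = F (u, 0) + of_int n"
        by (simp add: F_def n algebra_simps)
      then have "H (F (u, 1)) = H (F (u, 0))"
        using H_eq by blast
      then show "pathfinish (H \<circ> F \<circ> Pair u) = pathstart (H \<circ> F \<circ> Pair u)"
        by (simp add: pathstart_def pathfinish_def)
    qed
    then show ?thesis ..
  qed
  show ?thesis
  proof (rule that[OF cont_H H_img _ _ unroll])
    show "H (x + of_int n) = H x" for x n
      using H_eq by blast
    show "H s = G s" if "s \<in> {0..1}" for s
      using h_exp[OF that] by (simp add: H_def circ_def)
  qed
qed

lemma (in group) additive_int_eq_power:
  fixes A :: "int \<Rightarrow> 'a"
  assumes mem: "\<And>n. A n \<in> carrier G" and add: "\<And>m n. A (m + n) = A m \<otimes> A n"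
  shows "A n = A 1 [^] n"
proof (induction n rule: int_induct[where k = 0])
  case base
  show ?case
    using add[of 0 0] mem[of 0] by simp
next
  case (step1 i)
  then show ?case
    using add[of i 1] mem[of 1] int_pow_mult[of "A 1" i 1] by simp
next
  case (step2 i)
  have "A (i - 1) \<otimes> A 1 = A 1 [^] (i - 1) \<otimes> A 1"
    using step2 add[of "i - 1" 1] mem[of 1] int_pow_mult[of "A 1" "i - 1" 1] by simp
  then show ?case
    using mem by simp
qed

text \<open>
  The loops of degree \<open>m\<close> and \<open>n\<close> run one after the other lift, by periodicity, to a real path from
  \<open>0\<close> to \<open>m + n\<close>, and all such paths are homotopic. So the class is additive in the degree.
\<close>

lemma path_class_conjugate_periodic_power:
  fixes H :: "real \<Rightarrow> 'a::topological_space" and n :: int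
  assumes H: "continuous_on UNIV H" "H \<in> UNIV \<rightarrow> S"
    and periodic: "\<And>x n. H (x + of_int n) = H x"
    and \<sigma>: "path_from_to S b (H 0) \<sigma>"
  shows "path_class S (\<sigma> +++ (\<lambda>s. H (of_int n * s)) +++ reversepath \<sigma>) =
    path_class S (\<sigma> +++ H +++ reversepath \<sigma>) [^]\<^bsub>pi1 S b\<^esub> n"
proof -
  have "b \<in> S"
    using \<sigma> pathstart_in_path_image unfolding path_from_to_def by blast
  interpret group "pi1 S b"
    by (rule group_pi1) fact
  define e where "e n = H \<circ> (\<lambda>s. of_int n * s)" for n :: int
  define A where "A n = path_class S (\<sigma> +++ e n +++ reversepath \<sigma>)" for n
  have line: "path_from_to UNIV x (x + y) (\<lambda>s. x + y * s)" for x y :: real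
    by (auto simp: path_from_to_def path_def pathstart_def pathfinish_def intro!: continuous_intros)
  have H_int: "H (of_int n) = H 0" for n
    using periodic[of 0 n] by simp
  have e: "path_from_to S (H 0) (H 0) (e n)" for n
    using path_from_to_image[OF line[of 0 "of_int n"] H] by (simp add: e_def H_int)
  have A_mem: "A n \<in> carrier (pi1 S b)" for n
    unfolding A_def by (rule path_class_in_pi1[OF path_from_to_conjugate[OF \<sigma> e \<sigma>]])
  have add: "A (m + n) = A m \<otimes>\<^bsub>pi1 S b\<^esub> A n" for m n
  proof -
    \<comment> \<open>Shifted by \<open>m\<close>, the lift of the second loop starts where the lift of the first one ends.\<close>
    have shift: "e n = H \<circ> (\<lambda>s. of_int m + of_int n * s)"
      using periodic[of "of_int n * _" m] by (simp add: e_def fun_eq_iff add.commute)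
    have "homotopic_paths S (e m +++ e n) (e (m + n))"
      unfolding shift unfolding e_def path_compose_join[symmetric]
    proof (rule homotopic_paths_continuous_image[OF _ H])
      show "homotopic_paths UNIV ((\<lambda>s. of_int m * s) +++ (\<lambda>s. of_int m + of_int n * s))
          (\<lambda>s. of_int (m + n) * s :: real)"
        using path_from_to_join[OF line[of 0 "of_int m"], simplified, OF line[of "of_int m" "of_int n"]]
          line[of 0 "of_int (m + n)"]
        by (intro convex_homotopic_paths) auto
    qed
    then show ?thesis
      unfolding A_def pi1_mult_conjugate[OF \<sigma> e \<sigma> e \<sigma>]
      by (intro path_class_conjugate_cong[symmetric, OF \<sigma> path_from_to_join[OF e e] \<sigma>])
  qed
  have "A n = A 1 [^]\<^bsub>pi1 S b\<^esub> n"
    by (rule additive_int_eq_power[OF A_mem add])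
  then show ?thesis
    by (simp add: A_def e_def o_def)
qed

section \<open>Tubular neighbourhoods\<close>

text \<open>
  The frontier lies in the closure of the open disc bundle, hence in the image of the closed disc
  bundle, which is compact and therefore closed in the Hausdorff space \<open>M\<close>.
\<close>

lemma exterior_boundary_subset_bundle:
  fixes M :: "'a::t2_space set"
  assumes cont: "continuous_on (sphere 0 1 \<times> UNIV) e" and img: "e ` (sphere 0 1 \<times> UNIV) \<subseteq> M"
    and N: "e ` (sphere 0 1 \<times> ball 0 1) = N"
  shows "exterior_boundary M N \<subseteq> e ` (sphere (0::complex) 1 \<times> (UNIV :: complex set))"
proof -
  let ?C = "e ` (sphere 0 1 \<times> cball (0::complex) 1)"
  have "compact ?C"
    by (intro compact_continuous_image continuous_on_subset[OF cont] compact_Times) auto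
  moreover have "?C \<subseteq> M"
    using img by blast
  ultimately have "closedin (top_of_set M) ?C"
    by (intro closed_subset compact_imp_closed)
  moreover have "M - (M - N) \<subseteq> ?C"
    using N ball_subset_cball[of "0::complex" 1] by blast
  ultimately have "top_of_set M closure_of (M - (M - N)) \<subseteq> ?C"
    by (simp add: closure_of_minimal)
  then show ?thesis
    unfolding exterior_boundary_def frontier_of_closures by auto
qed

text \<open>
  Shrinking the disc coordinate to zero moves the loop through the bundle to the core. This is the
  step that kills the meridian: it bounds a disc in the tubular neighbourhood.
\<close>

lemma exterior_boundary_loop_retracts_to_core:
  fixes M :: "'a::t2_space set"
  assumes tub: "is_tubular_nbhd M K N" and l: "path_from_to (exterior_boundary M N) c c l"
  obtains l' c' where "homotopic_loops M l l'" "path_from_to K c' c' l'"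
proof -
  let ?E = "sphere (0::complex) 1 \<times> (UNIV :: complex set)"
  obtain e where emb: "embedding_map (top_of_set ?E) (top_of_set M) e"
    and K: "e ` (sphere 0 1 \<times> {0}) = K" and N: "e ` (sphere 0 1 \<times> ball 0 1) = N"
    using tub unfolding is_tubular_nbhd_def by blast
  have e_cont: "continuous_on ?E e" and e_img: "e ` ?E \<subseteq> M"
    using continuous_map_in_subtopology emb
    unfolding embedding_map_def homeomorphic_map_maps homeomorphic_maps_def
    by (auto simp: continuous_map_in_subtopology)
  obtain e' where e': "continuous_on (e ` ?E) e'" "\<And>v. v \<in> ?E \<Longrightarrow> e' (e v) = v"
    using emb e_img unfolding embedding_map_def homeomorphic_map_maps homeomorphic_maps_def
    by (auto simp: subtopology_subtopology Int_absorb1)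
  have l_img: "l s \<in> e ` ?E" if "s \<in> {0..1}" for s
  proof -
    have "l s \<in> exterior_boundary M N"
      using l that by (auto simp: path_from_to_def path_image_def)
    then show ?thesis
      using exterior_boundary_subset_bundle[OF e_cont e_img N] by blast
  qed
  define v where "v = e' \<circ> l"
  have v: "v s \<in> ?E" "e (v s) = l s" if "s \<in> {0..1}" for s
    using l_img[OF that] e'(2) by (auto simp: v_def)
  have v_cont: "continuous_on {0..1} v"
    unfolding v_def using l l_img
    by (intro continuous_on_compose continuous_on_subset[OF e'(1)])
      (auto simp: path_from_to_def path_def)
  have v_loop: "v 1 = v 0"
    using l by (simp add: v_def path_from_to_def pathstart_def pathfinish_def)
  define F where "F w = (fst (v (snd w)), (1 - fst w) *\<^sub>R snd (v (snd w)))" for w :: "real \<times> real"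
  have "continuous_on ({0..1} \<times> {0..1}) (\<lambda>w::real \<times> real. v (snd w))"
    by (rule continuous_on_compose2[OF v_cont]) (auto intro!: continuous_intros)
  then have F_cont: "continuous_on ({0..1} \<times> {0..1}) F"
    unfolding F_def by (intro continuous_intros)
  have F_img: "F w \<in> ?E" if "snd w \<in> {0..1}" for w
    using v(1)[OF that] by (auto simp: F_def mem_Times_iff)
  define l' where "l' s = e (fst (v s), 0)" for s
  have hom: "homotopic_loops M l l'"
    unfolding homotopic_loops
  proof (intro exI conjI ballI)
    show "continuous_on ({0..1} \<times> {0..1}) (e \<circ> F)"
      by (intro continuous_on_compose F_cont continuous_on_subset[OF e_cont] image_subsetI F_img)
        (auto simp: mem_Times_iff)
    show "e \<circ> F \<in> {0..1} \<times> {0..1} \<rightarrow> M"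
      using F_img e_img by fastforce
  next
    fix s :: real assume "s \<in> {0..1}"
    then show "(e \<circ> F) (0, s) = l s" "(e \<circ> F) (1, s) = l' s"
      using v(2) by (simp_all add: F_def l'_def)
  next
    fix u :: real
    show "pathfinish (e \<circ> F \<circ> Pair u) = pathstart (e \<circ> F \<circ> Pair u)"
      using v_loop by (simp add: F_def pathstart_def pathfinish_def)
  qed
  have "l' s \<in> K" if "s \<in> {0..1}" for s
    using v(1)[OF that] K by (force simp: l'_def mem_Times_iff)
  then have "path_from_to K (pathstart l') (pathstart l') l'"
    using homotopic_loops_imp_path[OF hom] homotopic_loops_imp_loop[OF hom]
    by (auto simp: path_from_to_def path_image_def)
  with hom show ?thesis by (rule that)
qed

lemma exterior_boundary_subset: "exterior_boundary M N \<subseteq> M"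
  unfolding exterior_boundary_def using frontier_of_subset_topspace[of "top_of_set M"] by simp

section \<open>Unit quaternions\<close>

lemma group_SU2: "group SU2"
proof (rule groupI)
  let ?adj = "\<lambda>A :: complex^2^2. transpose (map_matrix cnj A)"
  have adj_mult: "?adj (A ** C) = ?adj C ** ?adj A" for A C
    by (simp add: mat2_eq_iff mat2_mult transpose_def map_matrix_def mult.commute)
  have adj_adj: "?adj (?adj A) = A" for A
    by (simp add: mat2_eq_iff transpose_def map_matrix_def)
  have det_adj: "det (?adj A) = cnj (det A)" for A
    by (simp add: det_2 transpose_def map_matrix_def mult.commute)
  show "\<one>\<^bsub>SU2\<^esub> \<in> carrier SU2"
    by (simp add: SU2_def mat2_eq_iff mat2_mult transpose_def map_matrix_def mat_def det_2)
  fix A assume A: "A \<in> carrier SU2"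
  show "\<one>\<^bsub>SU2\<^esub> \<otimes>\<^bsub>SU2\<^esub> A = A"
    by (simp add: SU2_def)
  have "?adj A \<in> carrier SU2" "?adj A \<otimes>\<^bsub>SU2\<^esub> A = \<one>\<^bsub>SU2\<^esub>"
    using A matrix_left_right_inverse[of A "?adj A"] det_adj[of A] by (auto simp: SU2_def adj_adj)
  then show "\<exists>C\<in>carrier SU2. C \<otimes>\<^bsub>SU2\<^esub> A = \<one>\<^bsub>SU2\<^esub>"
    by blast
  fix C assume C: "C \<in> carrier SU2"
  have "(A ** C) ** ?adj (A ** C) = A ** (C ** ?adj C) ** ?adj A"
    unfolding adj_mult by (simp only: matrix_mul_assoc)
  then show "A \<otimes>\<^bsub>SU2\<^esub> C \<in> carrier SU2"
    using A C by (simp add: SU2_def det_mul)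
  fix D
  show "(A \<otimes>\<^bsub>SU2\<^esub> C) \<otimes>\<^bsub>SU2\<^esub> D = A \<otimes>\<^bsub>SU2\<^esub> (C \<otimes>\<^bsub>SU2\<^esub> D)"
    by (simp add: SU2_def matrix_mul_assoc)
qed

definition unit_phase :: "real \<Rightarrow> complex^2^2" where
  "unit_phase x = quat (exp (2 * pi * \<i> * complex_of_real x)) 0"

lemma unit_phase_in_SU2: "unit_phase x \<in> carrier SU2"
proof -
  have "exp (2 * pi * \<i> * complex_of_real x) * cnj (exp (2 * pi * \<i> * complex_of_real x)) = 1"
    by (simp add: exp_cnj flip: exp_add)
  then show ?thesis
    by (simp add: unit_phase_def SU2_def det_2 mat2_eq_iff mat2_mult transpose_def mat_def
        mult.commute)
qed

lemma unit_phase_add: "unit_phase (x + y) = unit_phase x \<otimes>\<^bsub>SU2\<^esub> unit_phase y"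
  by (simp add: unit_phase_def SU2_def mat2_eq_iff mat2_mult exp_add distrib_left)

lemma unit_phase_power: "unit_phase x [^]\<^bsub>SU2\<^esub> (n::int) = unit_phase (of_int n * x)"
  using group.additive_int_eq_power[OF group_SU2, of "\<lambda>n. unit_phase (of_int n * x)" n]
  by (simp add: unit_phase_in_SU2 unit_phase_add distrib_right)

lemma unit_phase_half_integer:
  assumes "2 * x \<in> \<int>"
  shows "unit_phase x \<in> {mat 1, - mat 1}"
proof -
  obtain k :: int where k: "2 * x = of_int k"
    using assms by (auto elim: Ints_cases)
  have "of_nat 2 * (2 * pi * \<i> * complex_of_real x) = of_real (of_int (2 * k) * pi) * \<i>"
    using k by (simp add: complex_eq_iff algebra_simps)
  then have "exp (2 * pi * \<i> * complex_of_real x) ^ 2 = exp (of_real (of_int (2 * k) * pi) * \<i>)"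
    by (metis exp_of_nat_mult)
  also have "\<dots> = 1"
    by (subst exp_eq_1) auto
  finally have "exp (2 * pi * \<i> * complex_of_real x) = 1 \<or> exp (2 * pi * \<i> * complex_of_real x) = - 1"
    by (simp add: power2_eq_1_iff)
  then show ?thesis
    by (auto simp: unit_phase_def mat2_eq_iff mat_def)
qed

lemma center_commutes_SU2:
  assumes "z \<in> {mat 1, - mat 1}" "c \<in> carrier SU2"
  shows "z \<otimes>\<^bsub>SU2\<^esub> c = c \<otimes>\<^bsub>SU2\<^esub> z"
  using assms center_SU2 by blast

section \<open>Half-integral phases\<close>

text \<open>
  Both entries of \<open>(\<phi>' - \<psi>') (B + I)\<close> are odd integers, for every choice of signs and integral
  translations. So orthogonality to \<open>(p, q)\<close> forces \<open>p + q\<close> to be even, and then \<open>3 p + q\<close> is even as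
  well. Up to sign and integers the two phases are \<open>(3 p + q) / 4\<close> and \<open>(p + q) / 4\<close>, which are
  multiples of \<open>1 / 2\<close>.
\<close>

lemma phase_of_orthogonal_class:
  fixes \<phi> \<psi> \<phi>' \<psi>' \<eta> \<theta> :: "real^2" and B :: "int^2^2" and p q :: int
  assumes B: "B = vector [vector [5, 2], vector [2, 1]]"
    and \<phi>: "\<phi> = vector [3/4, 1/4]" and \<psi>: "\<psi> = vector [1/4, 1/4]"
    and \<eta>: "\<forall>i. \<eta> $ i \<in> \<int>" and \<theta>: "\<forall>i. \<theta> $ i \<in> \<int>"
    and \<phi>': "\<phi>' = \<phi> + \<eta> \<or> \<phi>' = - \<phi> + \<eta>"
    and \<psi>': "\<psi>' = \<psi> + \<theta> \<or> \<psi>' = - \<psi> + \<theta>"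
    and orth: "((\<phi>' - \<psi>') v* (map_matrix real_of_int B + mat 1)) \<bullet>
      vector [real_of_int p, real_of_int q] = 0"
  shows "2 * (p * \<phi>' $ 1 + q * \<phi>' $ 2) \<in> \<int>" "2 * (p * \<psi>' $ 1 + q * \<psi>' $ 2) \<in> \<int>"
proof -
  obtain k1 k2 m1 m2 :: int
    where km: "\<eta> $ 1 = k1" "\<eta> $ 2 = k2" "\<theta> $ 1 = m1" "\<theta> $ 2 = m2"
    using \<eta> \<theta> by (metis Ints_cases)
  have "\<exists>s::int. (s = 1 \<or> s = -1) \<and> \<phi>' $ 1 = 3 * s / 4 + k1 \<and> \<phi>' $ 2 = s / 4 + k2"
    using \<phi>'
  proof
    assume "\<phi>' = \<phi> + \<eta>"
    then show ?thesis
      using km by (intro exI[of _ 1]) (simp add: \<phi>)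
  next
    assume "\<phi>' = - \<phi> + \<eta>"
    then show ?thesis
      using km by (intro exI[of _ "-1"]) (simp add: \<phi>)
  qed
  then obtain s :: int where s: "s = 1 \<or> s = -1" "\<phi>' $ 1 = 3 * s / 4 + k1" "\<phi>' $ 2 = s / 4 + k2"
    by blast
  have "\<exists>t::int. (t = 1 \<or> t = -1) \<and> \<psi>' $ 1 = t / 4 + m1 \<and> \<psi>' $ 2 = t / 4 + m2"
    using \<psi>'
  proof
    assume "\<psi>' = \<psi> + \<theta>"
    then show ?thesis
      using km by (intro exI[of _ 1]) (simp add: \<psi>)
  next
    assume "\<psi>' = - \<psi> + \<theta>"
    then show ?thesis
      using km by (intro exI[of _ "-1"]) (simp add: \<psi>)
  qed
  then obtain t :: int where t: "t = 1 \<or> t = -1" "\<psi>' $ 1 = t / 4 + m1" "\<psi>' $ 2 = t / 4 + m2"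
    by blast
  have "real_of_int ((5 * s - 2 * t + 6 * (k1 - m1) + 2 * (k2 - m2)) * p +
      (2 * s - t + 2 * (k1 - m1) + 2 * (k2 - m2)) * q) = 0"
    using orth s(2,3) t(2,3)
    by (simp add: B inner_vec_def vector_matrix_mult_def sum_2 mat_def field_simps)
  then have "(5 * s - 2 * t + 6 * (k1 - m1) + 2 * (k2 - m2)) * p +
      (2 * s - t + 2 * (k1 - m1) + 2 * (k2 - m2)) * q = 0"
    by (simp only: of_int_eq_0_iff)
  moreover have "odd (5 * s - 2 * t + 6 * (k1 - m1) + 2 * (k2 - m2))"
    "odd (2 * s - t + 2 * (k1 - m1) + 2 * (k2 - m2))"
    using s(1) t(1) by auto
  ultimately have "even (p + q)"
    by (metis even_add even_mult_iff dvd_0_right)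
  then obtain r where r: "p + q = 2 * r"
    by (rule evenE)
  have p: "real_of_int p = 2 * of_int r - of_int q"
    using arg_cong[OF r, of real_of_int] by simp
  have "2 * (p * \<phi>' $ 1 + q * \<phi>' $ 2) = of_int (s * (3 * r - q) + 2 * (p * k1 + q * k2))"
    by (simp add: s p field_simps)
  then show "2 * (p * \<phi>' $ 1 + q * \<phi>' $ 2) \<in> \<int>"
    by (metis Ints_of_int)
  have "2 * (p * \<psi>' $ 1 + q * \<psi>' $ 2) = of_int (t * r + 2 * (p * m1 + q * m2))"
    by (simp add: t p field_simps)
  then show "2 * (p * \<psi>' $ 1 + q * \<psi>' $ 2) \<in> \<int>"
    by (metis Ints_of_int)
qed

section \<open>Restriction to the boundary of a knot exterior\<close>

lemma fibre_incl_embeds: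
  assumes "is_mapping_torus m M Q"
  shows "continuous_on torus (fibre_incl Q)" "fibre_incl Q \<in> torus \<rightarrow> M" "inj_on (fibre_incl Q) torus"
proof -
  have Q: "continuous_on (torus \<times> {0..1}) Q" "Q \<in> torus \<times> {0..1} \<rightarrow> M"
    using assms quotient_imp_continuous_map[of "top_of_set (torus \<times> {0..1})" "top_of_set M" Q]
    by (auto simp: is_mapping_torus_def)
  have "continuous_on torus (\<lambda>z. Q (z, 0))"
    by (rule continuous_on_compose2[OF Q(1)]) (auto intro!: continuous_intros)
  then show "continuous_on torus (fibre_incl Q)"
    by (simp add: fibre_incl_def[abs_def])
  show "fibre_incl Q \<in> torus \<rightarrow> M"
    using Q(2) by (force simp: fibre_incl_def)
  show "inj_on (fibre_incl Q) torus"
  proof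
    fix z w assume zw: "z \<in> torus" "w \<in> torus" "fibre_incl Q z = fibre_incl Q w"
    have "\<forall>u\<in>torus \<times> {0..1}. \<forall>v\<in>torus \<times> {0..1}. Q u = Q v \<longleftrightarrow> u = v \<or>
        u = (m (fst v), 1) \<and> snd v = 0 \<or> v = (m (fst u), 1) \<and> snd u = 0"
      using assms by (simp add: is_mapping_torus_def)
    from this[rule_format, of "(z, 0)" "(w, 0)"] zw show "z = w"
      by (simp add: fibre_incl_def)
  qed
qed

lemma path_connected_torus: "path_connected torus"
  unfolding torus_def by (intro path_connected_Times path_connected_sphere) simp_all

text \<open>
  In the torus the curve is \<open>p x + q y\<close>; both the inclusion of the fibre and \<open>\<rho>\<close> are homomorphisms.
\<close>

lemma rho_fibre_curve:
  assumes M: "is_mapping_torus m M Q" and t: "t \<in> torus" and basis: "pi1_basis torus t X Y"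
    and g: "is_torus_curve t X Y p q g"
    and \<rho>: "is_rho (pi1 M (fibre_incl Q t)) (pi1_induced M (fibre_incl Q) X)
      (pi1_induced M (fibre_incl Q) Y) \<tau> \<phi> \<rho>"
    and \<sigma>: "path_from_to torus t (pathstart g) \<sigma>"
  shows "\<rho> (path_class M ((fibre_incl Q \<circ> \<sigma>) +++ (fibre_incl Q \<circ> g) +++ reversepath (fibre_incl Q \<circ> \<sigma>)))
    = unit_phase (p * \<phi> $ 1 + q * \<phi> $ 2)"
proof -
  let ?f = "fibre_incl Q"
  let ?T = "pi1 torus t" and ?G = "pi1 M (fibre_incl Q t)"
  note f = fibre_incl_embeds[OF M]
  have ft: "?f t \<in> M"
    using f(2) t by blast
  have groups: "group ?T" "group ?G"
    using group_pi1 t ft by blast+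
  have XY: "X \<in> carrier ?T" "Y \<in> carrier ?T"
    using basis by (auto simp: pi1_basis_def)
  note ind = pi1_induced_hom[OF f(1,2), of t]
  have \<rho>_hom: "\<rho> \<in> hom ?G SU2"
    and \<rho>_X: "\<rho> (pi1_induced M ?f X) = unit_phase (\<phi> $ 1)"
    and \<rho>_Y: "\<rho> (pi1_induced M ?f Y) = unit_phase (\<phi> $ 2)"
    using \<rho> by (auto simp: is_rho_def unit_phase_def)
  have g_path: "path_from_to torus (pathstart g) (pathstart g) g"
    using g by (auto simp: is_torus_curve_def path_from_to_def simple_path_imp_path)
  have power: "\<rho> (pi1_induced M ?f (Z [^]\<^bsub>?T\<^esub> n)) = \<rho> (pi1_induced M ?f Z) [^]\<^bsub>SU2\<^esub> n"
    if "Z \<in> carrier ?T" for Z and n :: int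
    using hom_int_pow[OF ind that groups] hom_int_pow[OF \<rho>_hom hom_in_carrier[OF ind that]
        groups(2) group_SU2] by simp
  have closed: "Z [^]\<^bsub>?T\<^esub> n \<in> carrier ?T" if "Z \<in> carrier ?T" for Z and n :: int
    using group.int_pow_closed[OF groups(1) that] .
  have "path_class torus (\<sigma> +++ g +++ reversepath \<sigma>) = X [^]\<^bsub>?T\<^esub> p \<otimes>\<^bsub>?T\<^esub> Y [^]\<^bsub>?T\<^esub> q"
    using g \<sigma> pi1_along_class[OF \<sigma> g_path order_refl] by (simp add: is_torus_curve_def)
  moreover have "pi1_induced M ?f (path_class torus (\<sigma> +++ g +++ reversepath \<sigma>)) =
      path_class M ((?f \<circ> \<sigma>) +++ (?f \<circ> g) +++ reversepath (?f \<circ> \<sigma>))"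
    using pi1_induced_class[OF path_from_to_conjugate[OF \<sigma> g_path \<sigma>] f(1,2)]
    by (simp add: path_compose_join path_compose_reversepath)
  ultimately have "\<rho> (path_class M ((?f \<circ> \<sigma>) +++ (?f \<circ> g) +++ reversepath (?f \<circ> \<sigma>))) =
      \<rho> (pi1_induced M ?f (X [^]\<^bsub>?T\<^esub> p) \<otimes>\<^bsub>?G\<^esub> pi1_induced M ?f (Y [^]\<^bsub>?T\<^esub> q))"
    using hom_mult[OF ind closed[OF XY(1)] closed[OF XY(2)]] by metis
  also have "\<dots> = \<rho> (pi1_induced M ?f (X [^]\<^bsub>?T\<^esub> p)) \<otimes>\<^bsub>SU2\<^esub> \<rho> (pi1_induced M ?f (Y [^]\<^bsub>?T\<^esub> q))"
    by (intro hom_mult[OF \<rho>_hom] hom_in_carrier[OF ind] closed XY)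
  also have "\<dots> = unit_phase (p * \<phi> $ 1 + q * \<phi> $ 2)"
    by (simp add: power XY \<rho>_X \<rho>_Y unit_phase_power unit_phase_add)
  finally show ?thesis .
qed

text \<open>
  A loop in the boundary is freely homotopic in \<open>M\<close> to a loop in the knot, that is, to a power of the
  knot. The latter goes to a power of the phase of the knot, which is central, and free homotopy
  preserves central values.
\<close>

lemma central_on_exterior_boundary:
  fixes M :: "'a::t2_space set"
  assumes M: "is_mapping_torus m M Q" and t: "t \<in> torus" and basis: "pi1_basis torus t X Y"
    and g: "is_torus_curve t X Y p q g"
    and N: "is_tubular_nbhd M (fibre_incl Q ` path_image g) N"
    and \<rho>: "is_rho (pi1 M (fibre_incl Q t)) (pi1_induced M (fibre_incl Q) X)
      (pi1_induced M (fibre_incl Q) Y) \<tau> \<phi> \<rho>"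
    and half: "2 * (p * \<phi> $ 1 + q * \<phi> $ 2) \<in> \<int>"
  shows "central_on M (fibre_incl Q t) (exterior_boundary M N) \<rho>"
  unfolding central_on_def
proof (intro ballI allI impI subsetI)
  let ?f = "fibre_incl Q"
  let ?G = "pi1 M (fibre_incl Q t)"
  let ?x = "p * \<phi> $ 1 + q * \<phi> $ 2"
  fix c \<sigma>1 A
  assume \<sigma>1: "path_from_to M (?f t) c \<sigma>1"
    and "A \<in> \<rho> ` pi1_along M \<sigma>1 ` carrier (pi1 (exterior_boundary M N) c)"
  then obtain l where l: "path_from_to (exterior_boundary M N) c c l"
    and A: "A = \<rho> (path_class M (\<sigma>1 +++ l +++ reversepath \<sigma>1))"
    using pi1_along_class[OF \<sigma>1 _ exterior_boundary_subset] by (auto simp: pi1_carrier_iff)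
  note f = fibre_incl_embeds[OF M]
  have g_simple: "simple_path g" "path_image g \<subseteq> torus" "pathfinish g = pathstart g"
    using g by (auto simp: is_torus_curve_def)
  define K where "K = ?f ` path_image g"
  have K: "path_image (?f \<circ> g) = K" "K \<subseteq> M"
    using f(2) g_simple(2) by (auto simp: K_def path_image_compose)
  have "simple_path (?f \<circ> g)"
    by (intro simple_path_continuous_image g_simple continuous_on_subset[OF f(1)] inj_on_subset[OF f(3)])
  moreover have "pathfinish (?f \<circ> g) = pathstart (?f \<circ> g)"
    by (simp add: pathfinish_compose pathstart_compose g_simple)
  ultimately obtain H where H: "continuous_on UNIV H" "H \<in> UNIV \<rightarrow> K"
    and periodic: "\<And>x n. H (x + of_int n) = H x"
    and H_g: "\<And>s. s \<in> {0..1} \<Longrightarrow> H s = (?f \<circ> g) s"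
    and unroll: "\<And>c l. path_from_to K c c l \<Longrightarrow> \<exists>n. homotopic_loops K l (\<lambda>s. H (of_int n * s))"
    using simple_closed_curve_periodic_parametrization[of "?f \<circ> g"] unfolding K(1) by blast
  obtain l' c' where l': "homotopic_loops M l l'" "path_from_to K c' c' l'"
    using exterior_boundary_loop_retracts_to_core[OF N l] unfolding K_def by blast
  obtain n where "homotopic_loops K l' (\<lambda>s. H (of_int n * s))"
    using unroll[OF l'(2)] by blast
  then have free: "homotopic_loops M l (\<lambda>s. H (of_int n * s))"
    using homotopic_loops_trans[OF l'(1)] homotopic_loops_subset[OF _ K(2)] by blast
  have "pathstart g \<in> torus"
    using g_simple(2) pathstart_in_path_image by blast
  then obtain \<sigma> where \<sigma>: "path_from_to torus t (pathstart g) \<sigma>"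
    using path_connected_torus t unfolding path_connected_def path_from_to_def by blast
  define \<sigma>' where "\<sigma>' = ?f \<circ> \<sigma>"
  have H0: "H 0 = ?f (pathstart g)"
    using H_g[of 0] by (simp add: pathstart_def)
  have \<sigma>': "path_from_to M (?f t) (H 0) \<sigma>'"
    unfolding \<sigma>'_def H0 by (rule path_from_to_image[OF \<sigma> f(1,2)])
  have H_M: "H \<in> UNIV \<rightarrow> M"
    using H(2) K(2) by blast
  have H_loop: "path_from_to M (H 0) (H 0) H"
    using continuous_on_subset[OF H(1)] H_M periodic[of 0 1]
    by (auto simp: path_from_to_def path_def path_image_def pathstart_def pathfinish_def)
  have "homotopic_paths M H (?f \<circ> g)"
    using H_loop H_g by (intro homotopic_paths_eq) (auto simp: path_from_to_def)
  then have core: "\<rho> (path_class M (\<sigma>' +++ H +++ reversepath \<sigma>')) = unit_phase ?x"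
    using path_class_conjugate_cong[OF \<sigma>' H_loop \<sigma>']
      rho_fibre_curve[OF M t basis g \<rho> \<sigma>] by (simp add: \<sigma>'_def)
  have "?f t \<in> M"
    using f(2) t by blast
  then have "\<rho> (path_class M (\<sigma>' +++ (\<lambda>s. H (of_int n * s)) +++ reversepath \<sigma>')) =
      \<rho> (path_class M (\<sigma>' +++ H +++ reversepath \<sigma>')) [^]\<^bsub>SU2\<^esub> n"
    unfolding path_class_conjugate_periodic_power[OF H(1) H_M periodic \<sigma>']
    using \<rho> by (intro hom_int_pow group_pi1 group_SU2 path_class_in_pi1
        path_from_to_conjugate[OF \<sigma>' H_loop \<sigma>']) (auto simp: is_rho_def)
  then have conj_n: "\<rho> (path_class M (\<sigma>' +++ (\<lambda>s. H (of_int n * s)) +++ reversepath \<sigma>')) =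
      unit_phase (of_int n * ?x)"
    by (simp only: core unit_phase_power)
  have "2 * (of_int n * ?x) = of_int n * (2 * ?x)"
    by simp
  then have pm: "unit_phase (of_int n * ?x) \<in> {mat 1, - mat 1}"
    using half by (intro unit_phase_half_integer) (metis Ints_mult Ints_of_int)
  have "A = unit_phase (of_int n * ?x)"
    unfolding A
  proof (rule hom_central_value_free_homotopy[where \<rho> = \<rho>, OF group_SU2 _ free _ _ conj_n])
    show "\<rho> \<in> hom ?G SU2"
      using \<rho> by (simp add: is_rho_def)
    show "path_from_to M (?f t) (pathstart l) \<sigma>1"
      using \<sigma>1 l by (simp add: path_from_to_def)
    show "path_from_to M (?f t) (pathstart (\<lambda>s. H (of_int n * s))) \<sigma>'"
      using \<sigma>' by (simp add: pathstart_def)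
  qed (rule center_commutes_SU2[OF pm])
  with pm show "A \<in> {mat 1, - mat 1}"
    by simp
qed

section \<open>Centrality of both representations\<close>

theorem proposition6p2p1:
  fixes m :: "complex \<times> complex \<Rightarrow> complex \<times> complex"
    and M :: "'a::t2_space set"
    and Q :: "(complex \<times> complex) \<times> real \<Rightarrow> 'a"
    and t :: "complex \<times> complex"
    and X Y :: "(real \<Rightarrow> complex \<times> complex) set"
    and \<delta> g :: "real \<Rightarrow> complex \<times> complex"
    and B :: "int^2^2"
    and \<phi> \<psi> \<phi>' \<psi>' \<eta> \<theta> :: "real^2"
    and p q :: int
    and N :: "'a set"
    and \<rho> \<rho>' :: "(real \<Rightarrow> 'a) set \<Rightarrow> complex^2^2"
  assumes m: "orientation_preserving_homeo m"
    and M: "is_mapping_torus m M Q"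
    and t: "t \<in> torus"
    and basis: "pi1_basis torus t X Y"
    and monodromy: "is_monodromy_matrix m t X Y B"
    and \<delta>: "\<exists>s\<in>torus. m s = t \<and> path_from_to torus s t \<delta>"
    and B: "B = vector [vector [5, 2], vector [2, 1]]"
    and \<phi>: "\<phi> = vector [3/4, 1/4]"
    and \<psi>: "\<psi> = vector [1/4, 1/4]"
    and \<eta>: "\<forall>i. \<eta> $ i \<in> \<int>"
    and \<theta>: "\<forall>i. \<theta> $ i \<in> \<int>"
    and \<phi>': "\<phi>' = \<phi> + \<eta> \<or> \<phi>' = - \<phi> + \<eta>"
    and \<psi>': "\<psi>' = \<psi> + \<theta> \<or> \<psi>' = - \<psi> + \<theta>"
    and pq: "coprime p q"
    and g: "is_torus_curve t X Y p q g"
    and orth: "((\<phi>' - \<psi>') v* (map_matrix real_of_int B + mat 1)) \<bullet> vector [real_of_int p, real_of_int q] = 0"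
    and N: "is_tubular_nbhd M (fibre_incl Q ` path_image g) N"
    and \<rho>: "is_rho (pi1 M (fibre_incl Q t))
               (pi1_induced M (fibre_incl Q) X) (pi1_induced M (fibre_incl Q) Y)
               (stable_letter M Q t \<delta>) \<phi>' \<rho>"
    and \<rho>': "is_rho (pi1 M (fibre_incl Q t))
               (pi1_induced M (fibre_incl Q) X) (pi1_induced M (fibre_incl Q) Y)
               (stable_letter M Q t \<delta>) \<psi>' \<rho>'"
  shows "central_on M (fibre_incl Q t) (exterior_boundary M N) \<rho> \<and>
         central_on M (fibre_incl Q t) (exterior_boundary M N) \<rho>'"
proof
  note phases = phase_of_orthogonal_class[OF B \<phi> \<psi> \<eta> \<theta> \<phi>' \<psi>' orth]
  show "central_on M (fibre_incl Q t) (exterior_boundary M N) \<rho>"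
    by (rule central_on_exterior_boundary[OF M t basis g N \<rho> phases(1)])
  show "central_on M (fibre_incl Q t) (exterior_boundary M N) \<rho>'"
    by (rule central_on_exterior_boundary[OF M t basis g N \<rho>' phases(2)])
qed

end
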